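(* For integers $k$ let $$G_{n,2d}(k)=\binom{n+2d-1}{2d}-kn-\binom{\binom{n+d-1}{d}-k+1}{2}.$$ The function $G_{n,2d}(k)$ is maximized (over integers $k$) at $k=\binom{n+d-1}{d}-n$. Its value there, which is the largest gap, is $$\binom{n+2d-1}{2d}-n\binom{n+d-1}{d}+\binom{n}{2}.$$ The smallest integer value of $k$ that makes $G_{n,2d}(k)$ positive is the smallest integer strictly greater than $$\binom{n+d-1}{d}-n+\frac12-\sqrt{\left(n-\frac12\right)^2+2\binom{n+2d-1}{2d}-2n\binom{n+d-1}{d}}.$$
   Context: Here $n$ is the number of variables and $2d$ the (even) degree of real forms, and $\binom{x}{2}$ means $x(x-1)/2$. The number $G_{n,2d}(k)$ is the lower bound $\binom{n+2d-1}{2d}-kn$ for the dimension of the face of the cone of nonnegative forms of degree $2d$ in $n$ variables consisting of those vanishing on $S$, minus the upper bound $\binom{\binom{n+d-1}{d}-k+1}{2}$ for the dimension of the face of the cone of sums of squares of forms of degree $d$ consisting of those vanishing on $S$. Here $S\subset\mathbb{R}^n$ is a set of $k$ points that is $d$-independent, meaning two things. First, the forms of degree $d$ vanishing on $S$ have no common zeros outside $S$ (points regarded projectively). Second, for every $s\in S$ the forms of degree $d$ that vanish to order 2 at $s$ and vanish on the rest of $S$ form a vector space of codimension $|S|+n-1$ in the space of all forms of degree $d$ in $n$ variables. "Gap" refers to this difference of bounds.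
   Formalization: The claim about the smallest k with G positive is stated only for n ≥ 3, d ≥ 2, (n,d) ≠ (3,2); in the other cases with n, d ≥ 1 the largest gap is 0, so no integer k makes G positive and the claim as worded fails. *)

theory Defs
  imports Complex_Main
begin

text \<open>
  \<open>binom2 x\<close> is $\binom{x}{2}$ read as the polynomial $x(x-1)/2$. The argument may be negative:
  in \<open>gap\<close> it is $\binom{n+d-1}{d}-k+1$ with an arbitrary integer \<open>k\<close>.
\<close>

definition binom2 :: "real \<Rightarrow> real" where
  "binom2 x = x * (x - 1) / 2"

text \<open>
  $G_{n,2d}(k)$. The subtractions of 1 inside the binomial coefficients are on naturals,
  which is harmless for $n \ge 1$.
\<close>

definition gap :: "nat \<Rightarrow> nat \<Rightarrow> int \<Rightarrow> real" where
  "gap n d k =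
     real ((n + 2 * d - 1) choose (2 * d)) - of_int k * real n
       - binom2 (real ((n + d - 1) choose d) - of_int k + 1)"

definition is_smallest_int :: "(int \<Rightarrow> bool) \<Rightarrow> int \<Rightarrow> bool" where
  "is_smallest_int P k \<longleftrightarrow> P k \<and> (\<forall>j. P j \<longrightarrow> k \<le> j)"

end

theory Submission
  imports Defs
begin

text \<open>
  Write $N = \binom{n+d-1}{d}$ and $M = \binom{n+2d-1}{2d}$. Centred at $N - n$ the gap function is a
  downward parabola: for $k = N - n + t$ it equals $F - t(t-1)/2$ with
  $F = M - nN + \binom{n}{2}$. Since $t(t-1) \ge 0$ for every integer \<open>t\<close>, the maximum over the
  integers is \<open>F\<close>, attained at \<open>t = 0\<close> (and at \<open>t = 1\<close>).

  Completing the square, the gap is positive exactly when $|t - 1/2| < \sqrt{R}$ with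
  $R = 2F + 1/4 = (n - 1/2)^2 + 2M - 2nN$. The smallest integer above the lower end of this
  interval lies in the interval only if the interval contains an integer at all, which is the case
  iff it contains \<open>t = 0\<close>, that is, iff \<open>F > 0\<close>. So the actual content is the inequality \<open>F > 0\<close>
  for $n \ge 3$, $d \ge 2$, $(n,d) \ne (3,2)$ (lemma \<open>largest_gap_pos\<close>; for \<open>(3,2)\<close> one has
  \<open>F = 15 - 18 + 3 = 0\<close>).

  The inequality is proved by increasing \<open>d\<close> with \<open>n\<close> fixed. For \<open>d = 1\<close> one has \<open>F = 0\<close>. By
  Pascal's rule, with \<open>n = p + 2\<close>, passing from \<open>d\<close> to \<open>d + 1\<close> changes \<open>F\<close> by
  \[ \binom{p+2d+2}{p} + \binom{p+2d+1}{p} - (p+2)\binom{p+d+1}{p}. \]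
  The ratios of the first two binomials to the third grow with \<open>d\<close>, and for \<open>d = 1\<close> they telescope
  to $(p+3)(p+4)/12$ and $(p+3)/3$. The sum of these is $p + 2 + p(p-1)/12$, so the increments
  are never negative, and for \<open>p \<ge> 1\<close> they vanish only if \<open>p = d = 1\<close>, the step leading to
  \<open>(n,d) = (3,2)\<close>.
\<close>

section \<open>Ratios of binomial coefficients\<close>

text \<open>
  The absorption identity, with the lower index fixed: it gives the factor by which each of the
  binomials in the increment of the largest gap grows with \<open>p\<close>.
\<close>

lemma binomial_absorb_upper:
  "real (p + 1) * real ((Suc p + a) choose a) = real (p + 1 + a) * real ((p + a) choose a)"
proof -
  have "Suc (p + a) * ((p + a) choose p) = (Suc (p + a) choose Suc p) * Suc p"
    by (rule Suc_times_binomial_eq)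
  moreover have "(p + a) choose p = (p + a) choose a"
    using binomial_symmetric[of p "p + a"] by simp
  moreover have "Suc (p + a) choose Suc p = (Suc p + a) choose a"
    using binomial_symmetric[of "Suc p" "Suc p + a"] by simp
  ultimately have "(p + 1) * ((Suc p + a) choose a) = (p + 1 + a) * ((p + a) choose a)"
    by simp
  then show ?thesis
    by (metis of_nat_mult)
qed

text \<open>
  The bound is an equality for \<open>d = 1\<close>. When \<open>p\<close> grows by one, the left-hand binomial gains the factor
  $(p+2d+2)/(p+1)$ and the right-hand one $(p+d+2)/(p+1)$, and the excess
  $(p+3)(p+2d+2) - (p+4)(p+d+2) = (d-1)(p+2)$ is nonnegative.
\<close>

lemma binomial_ratio_linear:
  assumes "d \<ge> 1"
  shows "(real p + 3) * real ((p + (d + 1)) choose (d + 1))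
    \<le> 3 * real ((p + (2 * d + 1)) choose (2 * d + 1))"
proof (induction p)
  case 0
  show ?case by simp
next
  case (Suc p)
  let ?E = "real ((p + (d + 1)) choose (d + 1))"
  let ?B = "real ((p + (2 * d + 1)) choose (2 * d + 1))"
  let ?E' = "real ((Suc p + (d + 1)) choose (d + 1))"
  let ?B' = "real ((Suc p + (2 * d + 1)) choose (2 * d + 1))"
  have E': "(real p + 1) * ?E' = (real p + real d + 2) * ?E"
    using binomial_absorb_upper[of p "d + 1"] by (simp add: algebra_simps)
  have B': "(real p + 1) * ?B' = (real p + 2 * real d + 2) * ?B"
    using binomial_absorb_upper[of p "2 * d + 1"] by (simp add: algebra_simps)
  have "0 \<le> (real d - 1) * (real p + 2)"
    using assms by simp
  then have coeff: "(real p + 4) * (real p + real d + 2) \<le> (real p + 3) * (real p + 2 * real d + 2)"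
    by (simp add: algebra_simps)
  have "(real p + 1) * ((real p + 4) * ?E') = (real p + 4) * ((real p + 1) * ?E')"
    by (simp only: mult.left_commute)
  also have "\<dots> = ((real p + 4) * (real p + real d + 2)) * ?E"
    unfolding E' by (simp only: mult.assoc)
  also have "\<dots> \<le> ((real p + 3) * (real p + 2 * real d + 2)) * ?E"
    by (rule mult_right_mono[OF coeff]) simp
  also have "\<dots> = (real p + 2 * real d + 2) * ((real p + 3) * ?E)"
    by (simp only: mult.assoc mult.left_commute)
  also have "\<dots> \<le> (real p + 2 * real d + 2) * (3 * ?B)"
    by (rule mult_left_mono[OF Suc.IH]) simp
  also have "\<dots> = 3 * ((real p + 1) * ?B')"
    unfolding B' by (simp only: mult.left_commute)
  also have "\<dots> = (real p + 1) * (3 * ?B')"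
    by (simp only: mult.left_commute)
  finally have "(real p + 4) * ?E' \<le> 3 * ?B'"
    by (rule mult_left_le_imp_le) simp
  then show ?case
    by (simp add: add.commute)
qed

text \<open>
  Again with equality for \<open>d = 1\<close>; the left-hand binomial now gains the factor $(p+2d+3)/(p+1)$, and
  $(p+3)(p+2d+3) - (p+5)(p+d+2) = (d-1)(p+1)$.
\<close>

lemma binomial_ratio_quadratic:
  assumes "d \<ge> 1"
  shows "(real p + 3) * (real p + 4) * real ((p + (d + 1)) choose (d + 1))
    \<le> 12 * real ((p + (2 * d + 2)) choose (2 * d + 2))"
proof (induction p)
  case 0
  show ?case by simp
next
  case (Suc p)
  let ?E = "real ((p + (d + 1)) choose (d + 1))"
  let ?A = "real ((p + (2 * d + 2)) choose (2 * d + 2))"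
  let ?E' = "real ((Suc p + (d + 1)) choose (d + 1))"
  let ?A' = "real ((Suc p + (2 * d + 2)) choose (2 * d + 2))"
  have E': "(real p + 1) * ?E' = (real p + real d + 2) * ?E"
    using binomial_absorb_upper[of p "d + 1"] by (simp add: algebra_simps)
  have A': "(real p + 1) * ?A' = (real p + 2 * real d + 3) * ?A"
    using binomial_absorb_upper[of p "2 * d + 2"] by (simp add: algebra_simps)
  have "0 \<le> (real d - 1) * (real p + 1)"
    using assms by simp
  then have "(real p + 5) * (real p + real d + 2) \<le> (real p + 3) * (real p + 2 * real d + 3)"
    by (simp add: algebra_simps)
  then have coeff: "(real p + 4) * ((real p + 5) * (real p + real d + 2))
      \<le> (real p + 4) * ((real p + 3) * (real p + 2 * real d + 3))"
    by (rule mult_left_mono) simp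
  have "(real p + 1) * ((real p + 4) * (real p + 5) * ?E')
      = (real p + 4) * (real p + 5) * ((real p + 1) * ?E')"
    by (simp only: mult.left_commute)
  also have "\<dots> = (real p + 4) * ((real p + 5) * (real p + real d + 2)) * ?E"
    unfolding E' by (simp only: mult.assoc)
  also have "\<dots> \<le> (real p + 4) * ((real p + 3) * (real p + 2 * real d + 3)) * ?E"
    by (rule mult_right_mono[OF coeff]) simp
  also have "\<dots> = (real p + 2 * real d + 3) * ((real p + 3) * (real p + 4) * ?E)"
    by (simp only: mult_ac)
  also have "\<dots> \<le> (real p + 2 * real d + 3) * (12 * ?A)"
    by (rule mult_left_mono[OF Suc.IH]) simp
  also have "\<dots> = 12 * ((real p + 1) * ?A')"
    unfolding A' by (simp only: mult.left_commute)
  also have "\<dots> = (real p + 1) * (12 * ?A')"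
    by (simp only: mult.left_commute)
  finally have "(real p + 4) * (real p + 5) * ?E' \<le> 12 * ?A'"
    by (rule mult_left_le_imp_le) simp
  then show ?case
    by (simp add: add.commute)
qed

section \<open>Positivity of the largest gap\<close>

definition largest_gap :: "nat \<Rightarrow> nat \<Rightarrow> real" where
  "largest_gap n d =
     real ((n + 2 * d - 1) choose (2 * d)) - real n * real ((n + d - 1) choose d) + binom2 (real n)"

lemma largest_gap_one: "largest_gap (Suc m) 1 = 0"
proof -
  have "real ((m + 2) choose 2) = (real m + 2) * (real m + 1) / 2"
    using choose_two[of "m + 2"] by (simp add: real_of_nat_div algebra_simps)
  moreover have "(Suc m + 2 * 1 - 1) choose (2 * 1) = (m + 2) choose 2"
    and "(Suc m + 1 - 1) choose 1 = Suc m"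
    by simp_all
  ultimately show ?thesis
    unfolding largest_gap_def binom2_def by (simp only:) (simp add: field_simps)
qed

text \<open>Two applications of Pascal's rule to the first binomial and one to the second.\<close>

lemma largest_gap_Suc:
  "largest_gap (p + 2) (Suc d) = largest_gap (p + 2) d
     + real ((p + (2 * d + 2)) choose (2 * d + 2)) + real ((p + (2 * d + 1)) choose (2 * d + 1))
     - (real p + 2) * real ((p + (d + 1)) choose (d + 1))"
proof -
  have "(p + 2 + 2 * Suc d - 1) choose (2 * Suc d)
      = ((p + 2 + 2 * d - 1) choose (2 * d)) + ((p + (2 * d + 1)) choose (2 * d + 1))
        + ((p + (2 * d + 2)) choose (2 * d + 2))"
    by simp
  moreover have "(p + 2 + Suc d - 1) choose Suc d
      = ((p + 2 + d - 1) choose d) + ((p + (d + 1)) choose (d + 1))"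
    by simp
  ultimately show ?thesis
    unfolding largest_gap_def by (simp add: algebra_simps)
qed

lemma largest_gap_increment:
  assumes "d \<ge> 1"
  shows "12 * (largest_gap (p + 2) (Suc d) - largest_gap (p + 2) d)
    \<ge> real p * (real p - 1) * real ((p + (d + 1)) choose (d + 1))"
  using binomial_ratio_linear[OF assms, of p] binomial_ratio_quadratic[OF assms, of p]
  unfolding largest_gap_Suc by (simp add: algebra_simps)

lemma largest_gap_mono:
  assumes "d \<ge> 1"
  shows "largest_gap (p + 2) d \<le> largest_gap (p + 2) (Suc d)"
proof -
  have "0 \<le> real p * (real p - 1)"
    by (cases p) auto
  then have "0 \<le> real p * (real p - 1) * real ((p + (d + 1)) choose (d + 1))"
    by (rule mult_nonneg_nonneg) simp
  then have "0 \<le> 12 * (largest_gap (p + 2) (Suc d) - largest_gap (p + 2) d)"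
    using largest_gap_increment[OF assms] by (rule order.trans)
  then show ?thesis
    by simp
qed

text \<open>
  For \<open>p \<ge> 2\<close> the bound on the increment is already strict. For \<open>p = 1\<close> it only gives \<open>0\<close>, but then
  the increment is $(2d+3) + (2d+2) - 3(d+2) = d - 1$.
\<close>

lemma largest_gap_strict_mono:
  assumes "d \<ge> 1" and "p \<ge> 1" and "(p, d) \<noteq> (1, 1)"
  shows "largest_gap (p + 2) d < largest_gap (p + 2) (Suc d)"
proof (cases "p = 1")
  case True
  with assms have "d \<ge> 2" by simp
  then show ?thesis
    unfolding True largest_gap_Suc by simp
next
  case False
  with assms have "0 < real p * (real p - 1)"
    by simp
  moreover have "0 < real ((p + (d + 1)) choose (d + 1))"
    using zero_less_binomial[of "d + 1" "p + (d + 1)"] by linarith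
  ultimately have "0 < real p * (real p - 1) * real ((p + (d + 1)) choose (d + 1))"
    by (rule mult_pos_pos)
  then have "0 < 12 * (largest_gap (p + 2) (Suc d) - largest_gap (p + 2) d)"
    using largest_gap_increment[OF assms(1)] by (rule less_le_trans)
  then show ?thesis
    by simp
qed

lemma largest_gap_nonneg:
  assumes "d \<ge> 1"
  shows "0 \<le> largest_gap (p + 2) d"
  using assms
proof (induction d rule: nat_induct_at_least)
  case base
  show ?case using largest_gap_one[of "Suc p"] by simp
next
  case (Suc d)
  then show ?case using largest_gap_mono[of d p] by linarith
qed

text \<open>
  The step from \<open>d - 1\<close> to \<open>d\<close> is strict, because for \<open>n \<ge> 3\<close> the only step that is not is the one
  ending at \<open>(n, d) = (3, 2)\<close>.
\<close>

lemma largest_gap_pos: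
  assumes "n \<ge> 3" and "d \<ge> 2" and "(n, d) \<noteq> (3, 2)"
  shows "0 < largest_gap n d"
proof -
  define p e where "p = n - 2" and "e = d - 1"
  have n: "n = p + 2" and d: "d = Suc e" and "p \<ge> 1" and "e \<ge> 1" and "(p, e) \<noteq> (1, 1)"
    using assms by (auto simp: p_def e_def)
  then show ?thesis
    using largest_gap_nonneg[of e p] largest_gap_strict_mono[of e p] by simp
qed

section \<open>The gap function as a parabola\<close>

lemma gap_parabola:
  "gap n d (int ((n + d - 1) choose d) - int n + t)
     = largest_gap n d - of_int t * (of_int t - 1) / 2"
  by (simp add: gap_def largest_gap_def binom2_def field_simps)

text \<open>
  Such a \<open>g\<close> is positive exactly on an open interval centred at \<open>a + 1/2\<close>. Its radius exceeds \<open>1/2\<close>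
  because \<open>F > 0\<close>, so it contains \<open>a\<close>; its smallest integer is then at most \<open>a\<close>, and only the lower
  end of the interval matters for it.
\<close>

lemma smallest_int_parabola_pos:
  fixes F c :: real
  assumes "0 < F" and g: "\<And>t. g (a + t) = F - of_int t * (of_int t - 1) / 2"
    and c: "c = of_int a + 1 / 2 - sqrt (2 * F + 1 / 4)"
  shows "\<exists>k. is_smallest_int (\<lambda>j. g j > 0) k \<and> is_smallest_int (\<lambda>j. of_int j > c) k"
proof -
  let ?r = "sqrt (2 * F + 1 / 4)"
  define k where "k = \<lfloor>c\<rfloor> + 1"
  have least: "is_smallest_int (\<lambda>j. of_int j > c) k"
    unfolding is_smallest_int_def k_def by (auto simp: floor_less_iff add1_zle_eq)
  have pos_iff: "g j > 0 \<longleftrightarrow> \<bar>of_int (j - a) - 1 / 2\<bar> < ?r" for j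
  proof -
    have "g j = F - of_int (j - a) * (of_int (j - a) - 1) / 2"
      using g[of "j - a"] by simp
    moreover have "(of_int (j - a) - 1 / 2)\<^sup>2
        = of_int (j - a) * (of_int (j - a) - 1) + (1 / 4 :: real)"
      by (simp add: power2_eq_square algebra_simps)
    ultimately have "g j > 0 \<longleftrightarrow> (of_int (j - a) - 1 / 2)\<^sup>2 < 2 * F + 1 / 4"
      by linarith
    also have "\<dots> \<longleftrightarrow> \<bar>of_int (j - a) - 1 / 2\<bar> < ?r"
      by (metis real_sqrt_abs real_sqrt_less_iff)
    finally show ?thesis .
  qed
  have "g a > 0"
    using g[of 0] \<open>0 < F\<close> by simp
  then have "of_int a > c"
    unfolding pos_iff c by simp
  then have "k \<le> a" and "of_int k > c"
    using least by (auto simp: is_smallest_int_def)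
  then have "g k > 0"
    unfolding pos_iff c by (simp add: abs_if)
  moreover have "k \<le> j" if "g j > 0" for j
  proof -
    have "of_int j > c"
      using that unfolding pos_iff c by (simp add: abs_less_iff)
    then show ?thesis
      using least by (auto simp: is_smallest_int_def)
  qed
  ultimately show ?thesis
    using least by (auto simp: is_smallest_int_def)
qed

theorem proposition5p2:
  fixes n d :: nat
  assumes "n \<ge> 1" and "d \<ge> 1"
  shows
    "(\<forall>k. gap n d k \<le> gap n d (int ((n + d - 1) choose d) - int n))
     \<and> gap n d (int ((n + d - 1) choose d) - int n)
         = real ((n + 2 * d - 1) choose (2 * d)) - real n * real ((n + d - 1) choose d)
             + binom2 (real n)
     \<and> (n \<ge> 3 \<and> d \<ge> 2 \<and> (n, d) \<noteq> (3, 2) \<longrightarrow>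
          (\<exists>k. is_smallest_int (\<lambda>j. gap n d j > 0) k
             \<and> is_smallest_int
                 (\<lambda>j. real_of_int j >
                    real ((n + d - 1) choose d) - real n + 1 / 2
                      - sqrt ((real n - 1 / 2)\<^sup>2 + 2 * real ((n + 2 * d - 1) choose (2 * d))
                                - 2 * real n * real ((n + d - 1) choose d))) k))"
proof (intro conjI allI impI)
  let ?N = "(n + d - 1) choose d"
  let ?M = "(n + 2 * d - 1) choose (2 * d)"
  let ?a = "int ?N - int n"
  have top: "gap n d ?a = largest_gap n d"
    using gap_parabola[of n d 0] by simp
  then show "gap n d ?a = real ?M - real n * real ?N + binom2 (real n)"
    by (simp add: largest_gap_def)
  show "gap n d k \<le> gap n d ?a" for k
  proof -
    define t where "t = k - ?a"
    have "0 \<le> t * (t - 1)"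
      by (cases "t \<le> 0") (auto intro: mult_nonpos_nonpos)
    then have "0 \<le> real_of_int t * (of_int t - 1)"
      by (metis of_int_0_le_iff of_int_1 of_int_diff of_int_mult)
    moreover have "gap n d k = largest_gap n d - of_int t * (of_int t - 1) / 2"
      using gap_parabola[of n d t] by (simp add: t_def)
    ultimately show ?thesis
      unfolding top by simp
  qed
  assume "n \<ge> 3 \<and> d \<ge> 2 \<and> (n, d) \<noteq> (3, 2)"
  then have "0 < largest_gap n d"
    by (intro largest_gap_pos) auto
  moreover have "real ?N - real n + 1 / 2 - sqrt ((real n - 1 / 2)\<^sup>2 + 2 * real ?M - 2 * real n * real ?N)
      = of_int ?a + 1 / 2 - sqrt (2 * largest_gap n d + 1 / 4)"
    by (simp add: largest_gap_def binom2_def power2_eq_square field_simps)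
  ultimately show "\<exists>k. is_smallest_int (\<lambda>j. gap n d j > 0) k
      \<and> is_smallest_int (\<lambda>j. real_of_int j > real ?N - real n + 1 / 2
          - sqrt ((real n - 1 / 2)\<^sup>2 + 2 * real ?M - 2 * real n * real ?N)) k"
    by (rule smallest_int_parabola_pos[OF _ gap_parabola])
qed

end
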